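(* Let $A$ be a complex unital $C^\star$-algebra with unit $\mathbf 1$. Let $\phi:A\to\mathbb C$ be a function (not assumed linear or multiplicative) such that (P1) $\phi(x)\phi(y)\in\sigma(xy)$ for all $x,y\in A$; (P2) $\phi(\mathbf 1)=1$; (P3) $\phi$ is continuous on $A$. Define $\psi_\phi:A\to\mathbb C$ by $\psi_\phi(x):=\phi\left(\operatorname{Re}(x)\right)+i\,\phi\left(\operatorname{Im}(x)\right)$. Then $\psi_\phi$ agrees with $\phi$ on $G_{\mathbf 1}(A)$, i.e. $\psi_\phi(x)=\phi(x)$ for every $x\in G_{\mathbf 1}(A)$.
   Context: For $x\in A$, $\sigma(x)$ denotes the spectrum of $x$ in $A$, $\operatorname{Re}(x):=(x+x^\star)/2$ and $\operatorname{Im}(x):=(x-x^\star)/(2i)$. $G(A)$ is the group of invertible elements of $A$, and $G_{\mathbf 1}(A)$ is the connected component of $G(A)$ containing $\mathbf 1$; it is well known that $G_{\mathbf 1}(A)=\{e^{x_1}\cdots e^{x_k}:k\in\mathbb N,\ x_j\in A\}$. *)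

theory Defs
  imports "HOL-Analysis.Analysis"
begin

text \<open>
  Complex unital C*-algebras. The library only has real Banach algebras, so the complex scalar
  multiplication is added on top of the real one and required to extend it.
  The superclass \<^class>\<open>real_normed_algebra_1\<close> contributes \<open>0 \<noteq> 1\<close>, submultiplicativity of the
  norm, and \<open>norm 1 = 1\<close>; the last of these is automatic in a nonzero unital C*-algebra.
\<close>

class cstar_algebra_1 = real_normed_algebra_1 + banach +
  fixes scaleC :: "complex \<Rightarrow> 'a \<Rightarrow> 'a"  (infixr \<open>*\<^sub>C\<close> 75)
    and star :: "'a \<Rightarrow> 'a"
  assumes scaleC_add_right: "a *\<^sub>C (x + y) = a *\<^sub>C x + a *\<^sub>C y"
    and scaleC_add_left: "(a + b) *\<^sub>C x = a *\<^sub>C x + b *\<^sub>C x"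
    and scaleC_scaleC: "a *\<^sub>C b *\<^sub>C x = (a * b) *\<^sub>C x"
    and scaleC_of_real: "complex_of_real r *\<^sub>C x = r *\<^sub>R x"
    and mult_scaleC_left: "(a *\<^sub>C x) * y = a *\<^sub>C (x * y)"
    and mult_scaleC_right: "x * (a *\<^sub>C y) = a *\<^sub>C (x * y)"
    and norm_scaleC: "norm (a *\<^sub>C x) = cmod a * norm x"
    and star_add: "star (x + y) = star x + star y"
    and star_scaleC: "star (a *\<^sub>C x) = cnj a *\<^sub>C star x"
    and star_mult: "star (x * y) = star y * star x"
    and star_star: "star (star x) = x"
    and cstar_identity: "norm (star x * x) = (norm x)\<^sup>2"

instantiation complex :: cstar_algebra_1
begin

definition scaleC_complex :: "complex \<Rightarrow> complex \<Rightarrow> complex"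
  where "scaleC_complex = (*)"

definition star_complex :: "complex \<Rightarrow> complex"
  where "star_complex = cnj"

instance
  by standard
    (simp_all add: scaleC_complex_def star_complex_def algebra_simps norm_mult
      power2_eq_square scaleR_conv_of_real)

end

definition invertibles :: "'a::cstar_algebra_1 set"
  where "invertibles = {x. \<exists>y. x * y = 1 \<and> y * x = 1}"

definition spectrum :: "'a::cstar_algebra_1 \<Rightarrow> complex set"
  where "spectrum x = {z. z *\<^sub>C 1 - x \<notin> invertibles}"

definition principal_component :: "'a::cstar_algebra_1 set"
  where "principal_component = connected_component_set invertibles 1"

definition Re_part :: "'a::cstar_algebra_1 \<Rightarrow> 'a"
  where "Re_part x = (1 / 2) *\<^sub>C (x + star x)"

definition Im_part :: "'a::cstar_algebra_1 \<Rightarrow> 'a"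
  where "Im_part x = (1 / (2 * \<i>)) *\<^sub>C (x - star x)"

definition psi :: "('a::cstar_algebra_1 \<Rightarrow> complex) \<Rightarrow> 'a \<Rightarrow> complex"
  where "psi \<phi> x = \<phi> (Re_part x) + \<i> * \<phi> (Im_part x)"

end

theory Submission
  imports Defs
begin

text \<open>
  The quotient f w / f x lies in the spectrum of \<open>x\<inverse> w\<close> for invertible x. If a is positive and
  invertible and b is self-adjoint, then \<open>a\<inverse> b\<close> has real spectrum, so f (a + i b) / f a has real
  part 1. Rotating a + i b by complex factors, this makes f additive on positive invertible elements
  and then complex linear on all elements whose real part is positive and invertible. The linear
  extension takes values in the spectrum, hence is a character (its value at \<open>h + \<i> h\<^sup>2\<close> forces it to
  preserve squares). All translates x -> f (y x) / f y are of the same kind, and the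
  characters they define are locally constant in y, which propagates the equality with the character
  from a neighbourhood of 1 to the principal component. Continuity is needed only for self-adjoint a,
  where f a is the limit of f (a + i t) for t tending to 0 from above.
\<close>

section \<open>Complex scalars and involution\<close>

interpretation scaleC: vector_space "scaleC :: complex \<Rightarrow> 'a \<Rightarrow> 'a::cstar_algebra_1"
proof
  show "1 *\<^sub>C x = x" for x :: 'a
    using scaleC_of_real[of 1 x] by simp
qed (simp_all add: scaleC_add_right scaleC_add_left scaleC_scaleC)

lemmas scaleC_simps = scaleC.scale_right_distrib scaleC.scale_left_distrib
  scaleC.scale_right_diff_distrib scaleC.scale_left_diff_distrib
  mult_scaleC_left mult_scaleC_right

lemma star_zero [simp]: "star (0::'a::cstar_algebra_1) = 0"
  using star_add[of "0::'a" 0] by simp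

lemma star_minus: "star (- x) = - star (x::'a::cstar_algebra_1)"
  using star_scaleC[of "-1" x] by simp

lemma star_diff: "star (x - y) = star x - star (y::'a::cstar_algebra_1)"
  using star_add[of x "- y"] by (simp add: star_minus)

lemma star_one [simp]: "star (1::'a::cstar_algebra_1) = 1"
  by (metis mult.left_neutral mult.right_neutral star_mult star_star)

lemmas star_simps = star_add star_diff star_minus star_scaleC star_mult star_star

text \<open>The C*-identity bounds norm(x)^2 by norm(star x) norm(x), and one factor cancels.
  Applying this to \<open>star x\<close> as well makes the involution isometric.\<close>

lemma norm_star_le: "norm (x::'a::cstar_algebra_1) \<le> norm (star x)"
proof (cases "x = 0")
  case False
  have "norm x * norm x \<le> norm (star x) * norm x"
    using cstar_identity[of x] norm_mult_ineq[of "star x" x] by (simp add: power2_eq_square)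
  then show ?thesis using False by simp
qed simp

lemma norm_star [simp]: "norm (star x) = norm (x::'a::cstar_algebra_1)"
  using norm_star_le[of x] norm_star_le[of "star x"] by (simp add: star_star)

lemma star_Re_part [simp]: "star (Re_part x) = Re_part (x::'a::cstar_algebra_1)"
  by (simp add: Re_part_def star_simps add.commute)

lemma star_Im_part [simp]: "star (Im_part x) = Im_part (x::'a::cstar_algebra_1)"
proof -
  have "star (Im_part x) = (- (1 / (2 * \<i>))) *\<^sub>C (star x - x)"
    by (simp add: Im_part_def star_simps)
  also have "\<dots> = Im_part x"
    unfolding Im_part_def by (metis minus_diff_eq scaleC.scale_minus_left scaleC.scale_minus_right)
  finally show ?thesis .
qed

lemma Re_Im_part: "x = Re_part x + \<i> *\<^sub>C Im_part (x::'a::cstar_algebra_1)"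
proof -
  have "Re_part x + \<i> *\<^sub>C Im_part x = (1/2 + 1/2) *\<^sub>C x + (1/2 - 1/2) *\<^sub>C star x"
    unfolding Re_part_def Im_part_def scaleC.scale_left_distrib scaleC.scale_left_diff_distrib
    by (simp add: scaleC.scale_right_distrib scaleC.scale_right_diff_distrib)
  then show ?thesis by simp
qed

lemma Re_part_eq:
  fixes a b :: "'a::cstar_algebra_1"
  assumes "star a = a" "star b = b"
  shows "Re_part (a + \<i> *\<^sub>C b) = a"
proof -
  have "Re_part (a + \<i> *\<^sub>C b) = (1/2) *\<^sub>C (a + a)"
    by (simp add: Re_part_def star_simps assms)
  also have "\<dots> = (1/2 + 1/2) *\<^sub>C a" 
    unfolding scaleC.scale_left_distrib scaleC.scale_right_distrib ..
  finally show ?thesis by simp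
qed

lemma Re_part_add: "Re_part (x + y) = Re_part x + Re_part (y::'a::cstar_algebra_1)"
  by (simp add: Re_part_def star_add scaleC_simps)

lemma Im_part_add: "Im_part (x + y) = Im_part x + Im_part (y::'a::cstar_algebra_1)"
  by (simp add: Im_part_def star_add scaleC_simps algebra_simps)

lemma Re_part_of_real: "Re_part (complex_of_real t *\<^sub>C (1::'a::cstar_algebra_1)) = of_real t *\<^sub>C 1"
  using Re_part_eq[of "complex_of_real t *\<^sub>C (1::'a)" 0] by (simp add: star_scaleC)

lemma norm_Re_part_le: "norm (Re_part x) \<le> norm (x::'a::cstar_algebra_1)"
  using norm_triangle_ineq[of x "star x"] by (simp add: Re_part_def norm_scaleC norm_divide)

lemma norm_scaleC_one [simp]: "norm (c *\<^sub>C (1::'a::cstar_algebra_1)) = cmod c"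
  by (simp add: norm_scaleC)

section \<open>Invertible elements and the spectrum\<close>

lemma invertiblesI: "x * y = 1 \<Longrightarrow> y * x = 1 \<Longrightarrow> x \<in> invertibles"
  by (auto simp: invertibles_def)

lemma invertiblesE:
  assumes "x \<in> invertibles" obtains y where "x * y = 1" "y * x = 1"
  using assms by (auto simp: invertibles_def)

lemma one_in_invertibles [simp]: "1 \<in> invertibles"
  by (rule invertiblesI[of _ 1]) auto

lemma invertibles_mult:
  assumes "x \<in> invertibles" "y \<in> invertibles"
  shows "x * y \<in> invertibles"
proof -
  obtain x' y' where *: "x * x' = 1" "x' * x = 1" "y * y' = 1" "y' * y = 1"
    using assms by (metis invertiblesE)
  have "x * y * (y' * x') = x * (y * y') * x'" "y' * x' * (x * y) = y' * (x' * x) * y"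
    by (simp_all add: mult.assoc)
  then show ?thesis using * by (intro invertiblesI[of _ "y' * x'"]) simp_all
qed

lemma invertibles_scaleC:
  assumes "x \<in> invertibles" "c \<noteq> 0"
  shows "c *\<^sub>C x \<in> invertibles"
proof -
  obtain y where "x * y = 1" "y * x = 1" using assms(1) by (rule invertiblesE)
  then show ?thesis using assms(2)
    by (intro invertiblesI[of _ "inverse c *\<^sub>C y"]) (simp_all add: scaleC_simps)
qed

text \<open>Neumann series: the sum \<open>s\<close> of the powers of \<open>h\<close> satisfies
  \<open>h * s = s - 1 = s * h\<close>.\<close>

lemma invertibles_one_minus:
  fixes h :: "'a::cstar_algebra_1"
  assumes "norm h < 1"
  shows "1 - h \<in> invertibles"
proof -
  define s where "s = (\<Sum>n. h ^ n)"
  have sum: "summable (\<lambda>n. h ^ n)"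
    using complete_algebra_summable_geometric[OF assms] .
  have "(\<Sum>n. h ^ Suc n) = s - 1"
    using suminf_split_head[OF sum] by (simp add: s_def)
  moreover have "(\<Sum>n. h ^ Suc n) = h * s"
    using suminf_mult[OF sum, of h] by (simp add: s_def)
  moreover have "(\<Sum>n. h ^ Suc n) = s * h"
    using suminf_mult2[OF sum, of h] by (simp add: s_def power_commutes)
  ultimately show ?thesis
    by (intro invertiblesI[of _ s]) (simp_all add: algebra_simps)
qed

lemma invertibles_near_one: "norm (x - 1) < 1 \<Longrightarrow> (x::'a::cstar_algebra_1) \<in> invertibles"
  using invertibles_one_minus[of "1 - x"] by (simp add: norm_minus_commute)

lemma spectrum_norm:
  fixes x :: "'a::cstar_algebra_1"
  assumes "z \<in> spectrum x"
  shows "cmod z \<le> norm x"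
proof (rule ccontr)
  assume less: "\<not> cmod z \<le> norm x"
  then have z: "z \<noteq> 0" by auto
  have "norm (inverse z *\<^sub>C x) < 1"
    using less z by (simp add: norm_scaleC norm_inverse norm_divide field_simps)
  then have "z *\<^sub>C (1 - inverse z *\<^sub>C x) \<in> invertibles"
    by (intro invertibles_scaleC invertibles_one_minus z)
  then show False using assms z by (simp add: spectrum_def scaleC_simps)
qed

lemma spectrum_shift: "z + c \<in> spectrum (x + c *\<^sub>C 1) \<longleftrightarrow> z \<in> spectrum x"
  by (simp add: spectrum_def scaleC_simps)

text \<open>A shift by \<open>c\<close> reduces this to the spectrum of 0, where the norm bound
  leaves only 0. Spectral membership thereby becomes an equation.\<close>

lemma spectrum_scaleC_one: "z \<in> spectrum (c *\<^sub>C (1::'a::cstar_algebra_1)) \<Longrightarrow> z = c"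
  using spectrum_norm[of "z - c" "0::'a"] spectrum_shift[of "z - c" c "0::'a"] by simp

text \<open>Arens' trick: in |z + \<i> t|^2 <= norm(h + \<i> t)^2 <= norm(h)^2 + t^2 the squares of
  the real number t cancel, leaving a bound on a function linear in t with slope 2 Im z.\<close>

lemma spectrum_selfadjoint:
  fixes h :: "'a::cstar_algebra_1"
  assumes h: "star h = h" and z: "z \<in> spectrum h"
  shows "Im z = 0"
proof (rule ccontr)
  assume "Im z \<noteq> 0"
  have bound: "(Re z)\<^sup>2 + (Im z)\<^sup>2 + 2 * Im z * t \<le> (norm h)\<^sup>2" for t :: real
  proof -
    let ?c = "\<i> * of_real t"
    have "cmod (z + ?c) \<le> norm (h + ?c *\<^sub>C 1)"
      using z by (intro spectrum_norm) (simp only: spectrum_shift)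
    then have "(cmod (z + ?c))\<^sup>2 \<le> (norm (h + ?c *\<^sub>C 1))\<^sup>2"
      by (simp add: power_mono)
    also have "\<dots> = norm (star (h + ?c *\<^sub>C 1) * (h + ?c *\<^sub>C 1))"
      by (simp add: cstar_identity)
    also have "star (h + ?c *\<^sub>C 1) * (h + ?c *\<^sub>C 1) = h * h + of_real (t\<^sup>2) *\<^sub>C 1"
      by (simp add: star_simps h scaleC_simps algebra_simps power2_eq_square)
    also have "norm \<dots> \<le> norm h * norm h + t\<^sup>2"
      using norm_triangle_ineq[of "h * h" "of_real (t\<^sup>2) *\<^sub>C 1"] norm_mult_ineq[of h h]
      by (simp del: of_real_power)
    finally show ?thesis
      unfolding cmod_power2 by (simp add: power2_eq_square algebra_simps)
  qed
  \<comment> \<open>This t makes 2 t Im z equal to norm(h)^2 + 1.\<close>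
  from bound[of "((norm h)\<^sup>2 + 1) / (2 * Im z)"] \<open>Im z \<noteq> 0\<close>
  show False using zero_le_power2[of "Re z"] zero_le_power2[of "Im z"] by simp
qed

text \<open>The Cayley transform of b is unitary, which bounds the resolvent of b at -i by 1.\<close>

lemma selfadjoint_resolvent:
  fixes b :: "'a::cstar_algebra_1"
  assumes b: "star b = b"
  obtains r where "(b + \<i> *\<^sub>C 1) * r = 1" "r * (b + \<i> *\<^sub>C 1) = 1" "norm r \<le> 1"
proof -
  have "- \<i> \<notin> spectrum b" using spectrum_selfadjoint[OF b, of "- \<i>"] by auto
  then have "(-1) *\<^sub>C ((- \<i>) *\<^sub>C 1 - b) \<in> invertibles"
    by (intro invertibles_scaleC) (auto simp: spectrum_def)
  then have "b + \<i> *\<^sub>C 1 \<in> invertibles" by (simp add: scaleC_simps add.commute)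
  then obtain r where r: "(b + \<i> *\<^sub>C 1) * r = 1" "r * (b + \<i> *\<^sub>C 1) = 1"
    by (rule invertiblesE)
  define w where "w = (b - \<i> *\<^sub>C 1) * r"
  have sr: "star r * (b - \<i> *\<^sub>C 1) = 1"
    using arg_cong[OF r(1), of star] by (simp add: star_simps b)
  have "star w * w = star r * ((b + \<i> *\<^sub>C 1) * (b - \<i> *\<^sub>C 1)) * r"
    by (simp add: w_def star_simps b mult.assoc)
  \<comment> \<open>Swapping the commuting factors puts \<open>star r\<close> and \<open>r\<close>
    next to the factors they cancel, so \<open>star w * w\<close> is 1.\<close>
  also have "(b + \<i> *\<^sub>C 1) * (b - \<i> *\<^sub>C 1) = (b - \<i> *\<^sub>C 1) * (b + \<i> *\<^sub>C 1)"
    by (simp add: scaleC_simps algebra_simps)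
  also have "star r * ((b - \<i> *\<^sub>C 1) * (b + \<i> *\<^sub>C 1)) * r
      = (star r * (b - \<i> *\<^sub>C 1)) * ((b + \<i> *\<^sub>C 1) * r)"
    by (simp add: mult.assoc)
  finally have "norm w = 1"
    using cstar_identity[of w] sr r by (simp add: power2_eq_1_iff) (smt (verit) norm_ge_zero)
  \<comment> \<open>The factors b + \<i> and b - \<i> differ by 2 \<i>, hence 2 \<i> r = 1 -
    w.\<close>
  have "(2 * \<i>) *\<^sub>C r = (b + \<i> *\<^sub>C 1) * r - w"
    unfolding w_def left_diff_distrib[symmetric]
    by (simp add: scaleC_simps flip: scaleC.scale_left_distrib)
  then have "norm ((2 * \<i>) *\<^sub>C r) \<le> 2"
    using norm_triangle_ineq4[of 1 w] \<open>norm w = 1\<close> r by simp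
  then have "norm r \<le> 1" by (simp add: norm_scaleC norm_mult)
  then show ?thesis using r that by blast
qed

text \<open>The positive invertible elements, described by norms to avoid functional calculus.\<close>

definition pos_cone :: "'a::cstar_algebra_1 set"
  where "pos_cone = {a. star a = a \<and> (\<exists>t>0. norm (a - complex_of_real t *\<^sub>C 1) < t)}"

lemma pos_cone_selfadjoint: "a \<in> pos_cone \<Longrightarrow> star a = a"
  by (simp add: pos_cone_def)

lemma pos_coneI:
  "star a = a \<Longrightarrow> norm (a - complex_of_real t *\<^sub>C 1) < t \<Longrightarrow> a \<in> pos_cone"
  unfolding pos_cone_def using le_less_trans[OF norm_ge_zero] by blast

lemma pos_coneE:
  assumes "a \<in> pos_cone"
  obtains t where "t > 0" "norm (a - complex_of_real t *\<^sub>C 1) < t"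
  using assms by (auto simp: pos_cone_def)

lemma pos_cone_add:
  assumes "a \<in> pos_cone" "b \<in> pos_cone"
  shows "a + b \<in> pos_cone"
proof -
  obtain t s where "norm (a - complex_of_real t *\<^sub>C 1) < t" "norm (b - complex_of_real s *\<^sub>C 1) < s"
    using assms by (metis pos_coneE)
  then have "norm ((a - complex_of_real t *\<^sub>C 1) + (b - complex_of_real s *\<^sub>C 1)) < t + s"
    by (intro norm_add_less)
  then show ?thesis using assms
    by (intro pos_coneI[of _ "t + s"])
      (simp_all add: star_simps pos_cone_selfadjoint scaleC_simps algebra_simps)
qed

lemma pos_cone_scale:
  assumes "a \<in> pos_cone" "r > 0"
  shows "complex_of_real r *\<^sub>C a \<in> pos_cone"
proof -
  obtain t where t: "t > 0" "norm (a - complex_of_real t *\<^sub>C 1) < t"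
    using assms by (metis pos_coneE)
  have "complex_of_real r *\<^sub>C a - complex_of_real (r * t) *\<^sub>C 1
      = complex_of_real r *\<^sub>C (a - complex_of_real t *\<^sub>C 1)"
    by (simp add: scaleC_simps)
  then have "norm (complex_of_real r *\<^sub>C a - complex_of_real (r * t) *\<^sub>C 1) < r * t"
    using t assms(2) by (simp only: norm_scaleC) simp
  then show ?thesis using assms
    by (intro pos_coneI[of _ "r * t"]) (simp_all add: star_simps pos_cone_selfadjoint)
qed

text \<open>The strict norm inequality leaves a gap, and a smaller self-adjoint perturbation keeps
  the same centre \<open>t\<close>.\<close>

lemma pos_cone_eventually:
  assumes "a \<in> pos_cone" "star b = b"
  shows "\<forall>\<^sub>F \<tau> in at_right 0. a + complex_of_real \<tau> *\<^sub>C b \<in> pos_cone"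
proof -
  obtain t where t: "t > 0" "norm (a - complex_of_real t *\<^sub>C 1) < t"
    using assms by (metis pos_coneE)
  \<comment> \<open>The summand 1 in the denominator covers \<open>b = 0\<close>.\<close>
  let ?d = "(t - norm (a - complex_of_real t *\<^sub>C 1)) / (norm b + 1)"
  have "norm b + 1 > 0" by (simp add: add_nonneg_pos)
  then have "?d > 0" using t by simp
  then have "\<forall>\<^sub>F \<tau> in at_right 0. \<tau> \<in> {0<..<?d}"
    by (rule eventually_at_right_real)
  then show ?thesis
  proof eventually_elim
    case (elim \<tau>)
    have "norm (complex_of_real \<tau> *\<^sub>C b) \<le> \<tau> * (norm b + 1)"
      using elim by (simp add: norm_scaleC)
    also have "\<dots> < t - norm (a - complex_of_real t *\<^sub>C 1)"
      using elim \<open>norm b + 1 > 0\<close> by (simp add: field_simps)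
    finally have "norm ((a - complex_of_real t *\<^sub>C 1) + complex_of_real \<tau> *\<^sub>C b) < t"
      using norm_triangle_ineq[of "a - complex_of_real t *\<^sub>C 1" "complex_of_real \<tau> *\<^sub>C b"] by simp
    then show ?case using assms
      by (intro pos_coneI[of _ t]) (simp_all add: star_simps pos_cone_selfadjoint algebra_simps)
  qed
qed

text \<open>Dividing by \<open>t\<close> turns \<open>a\<close> into 1 + h with norm(h) < 1 and
  \<open>b\<close> into \<open>c\<close>. Then c + \<i> (1 + h) = (c + \<i>) (1 + r \<i> h), and the
  resolvent bound norm(r) <= 1 makes the second factor invertible.\<close>

lemma selfadjoint_plus_i_pos_cone:
  assumes b: "star b = b" and a: "a \<in> pos_cone"
  shows "b + \<i> *\<^sub>C a \<in> invertibles"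
proof -
  obtain t where t: "t > 0" "norm (a - complex_of_real t *\<^sub>C 1) < t"
    using a by (metis pos_coneE)
  define h where "h = complex_of_real (1/t) *\<^sub>C a - 1"
  have a_eq: "a = complex_of_real t *\<^sub>C (1 + h)"
    using t by (simp add: h_def)
  then have "norm (complex_of_real t *\<^sub>C h) < t"
    using t(2) by (simp add: scaleC_simps)
  then have h: "norm h < 1" using t(1) by (simp add: norm_scaleC)
  define c where "c = complex_of_real (1/t) *\<^sub>C b"
  have b_eq: "b = complex_of_real t *\<^sub>C c" using t by (simp add: c_def)
  have "star c = c" by (simp add: c_def star_simps b)
  then obtain r where r: "(c + \<i> *\<^sub>C 1) * r = 1" "r * (c + \<i> *\<^sub>C 1) = 1" "norm r \<le> 1"
    by (rule selfadjoint_resolvent)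
  have "norm (r * (\<i> *\<^sub>C h)) \<le> norm r * norm h"
    using norm_mult_ineq[of r "\<i> *\<^sub>C h"] by (simp add: norm_scaleC)
  also have "\<dots> < 1" using r(3) h mult_right_mono[of "norm r" 1 "norm h"] by simp
  finally have "1 + r * (\<i> *\<^sub>C h) \<in> invertibles"
    by (intro invertibles_near_one) simp
  then have "complex_of_real t *\<^sub>C ((c + \<i> *\<^sub>C 1) * (1 + r * (\<i> *\<^sub>C h))) \<in> invertibles"
    using r t by (intro invertibles_scaleC invertibles_mult) (auto intro: invertiblesI)
  also have "(c + \<i> *\<^sub>C 1) * (1 + r * (\<i> *\<^sub>C h)) = c + \<i> *\<^sub>C 1 + \<i> *\<^sub>C h"
    by (simp only: distrib_left mult.assoc[symmetric] r) simp
  also have "complex_of_real t *\<^sub>C (c + \<i> *\<^sub>C 1 + \<i> *\<^sub>C h) = b + \<i> *\<^sub>C a"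
    by (simp add: a_eq b_eq scaleC_simps mult.commute add.assoc)
  finally show ?thesis .
qed

lemma pos_cone_plus_i_selfadjoint:
  assumes a: "a \<in> pos_cone" and b: "star b = b"
  shows "a + \<i> *\<^sub>C b \<in> invertibles"
proof -
  have "(- \<i>) *\<^sub>C (- b + \<i> *\<^sub>C a) \<in> invertibles"
    using a b by (intro invertibles_scaleC selfadjoint_plus_i_pos_cone) (simp_all add: star_simps)
  then show ?thesis by (simp add: scaleC_simps add.commute)
qed

section \<open>The analogue of the open right half plane\<close>

definition right_half :: "'a::cstar_algebra_1 set"
  where "right_half = {x. Re_part x \<in> pos_cone}"

lemma right_half_invertible: "x \<in> right_half \<Longrightarrow> x \<in> invertibles"
  using pos_cone_plus_i_selfadjoint[of "Re_part x" "Im_part x"] Re_Im_part[of x]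
  by (simp add: right_half_def)

lemma right_half_add: "x \<in> right_half \<Longrightarrow> y \<in> right_half \<Longrightarrow> x + y \<in> right_half"
  by (simp add: right_half_def Re_part_add pos_cone_add)

text \<open>\<open>Re_part\<close> is contractive and fixes real multiples of 1, so it maps the ball
  about t 1 into itself.\<close>

lemma right_half_near:
  assumes "norm (x - complex_of_real t *\<^sub>C 1) < t"
  shows "x \<in> right_half"
proof -
  have "Re_part x - complex_of_real t *\<^sub>C 1 = Re_part (x - complex_of_real t *\<^sub>C 1)"
    using Re_part_add[of "x - complex_of_real t *\<^sub>C 1" "complex_of_real t *\<^sub>C 1"]
    by (simp add: Re_part_of_real)
  then have "norm (Re_part x - complex_of_real t *\<^sub>C 1) < t"
    using norm_Re_part_le[of "x - complex_of_real t *\<^sub>C 1"] assms by simp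
  then show ?thesis unfolding right_half_def by (simp add: pos_coneI)
qed

lemma right_half_shift: "norm x < t \<Longrightarrow> x + complex_of_real t *\<^sub>C 1 \<in> right_half"
  by (rule right_half_near[of _ t]) simp

lemma right_half_of_real: "t > 0 \<Longrightarrow> complex_of_real t *\<^sub>C 1 \<in> right_half"
  by (rule right_half_near[of _ t]) simp

section \<open>Functions whose ratios lie in spectra\<close>

text \<open>Unlike the hypothesis on the given function, this property is inherited by
  the translates x -> f (y x) / f y with y invertible.\<close>

definition spectral_ratio :: "('a::cstar_algebra_1 \<Rightarrow> complex) \<Rightarrow> bool"
  where "spectral_ratio f \<longleftrightarrow> f 1 = 1 \<and>
    (\<forall>x x' w. x * x' = 1 \<longrightarrow> x' * x = 1 \<longrightarrow> f x \<noteq> 0 \<and> f w / f x \<in> spectrum (x' * w))"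

lemma spectral_ratioD:
  assumes "spectral_ratio f" "x * x' = 1" "x' * x = 1"
  shows "f x \<noteq> 0" "f w / f x \<in> spectrum (x' * w)"
  using assms by (auto simp: spectral_ratio_def)

lemma spectral_ratio_one: "spectral_ratio f \<Longrightarrow> f 1 = 1"
  by (simp add: spectral_ratio_def)

lemma spectral_ratio_spectrum: "spectral_ratio f \<Longrightarrow> f x \<in> spectrum x"
  using spectral_ratioD(2)[of f 1 1 x] by (simp add: spectral_ratio_one)

text \<open>The inverse of \<open>y * x\<close> is \<open>x' * y'\<close>, and its product with
  \<open>y * w\<close> is \<open>x' * w\<close>: the factor \<open>y\<close> cancels in the quotient
  and in the spectrum.\<close>

lemma spectral_ratio_translate:
  assumes f: "spectral_ratio f" and y: "y \<in> invertibles"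
  shows "spectral_ratio (\<lambda>x. f (y * x) / f y)"
proof -
  obtain y' where y': "y * y' = 1" "y' * y = 1" using y by (rule invertiblesE)
  have "f (y * x) / f y \<noteq> 0 \<and> f (y * w) / f y / (f (y * x) / f y) \<in> spectrum (x' * w)"
    if x: "x * x' = 1" "x' * x = 1" for x x' w
  proof -
    have "(y * x) * (x' * y') = y * (x * x') * y'" "(x' * y') * (y * x) = x' * (y' * y) * x"
      by (simp_all add: mult.assoc)
    then have inv: "(y * x) * (x' * y') = 1" "(x' * y') * (y * x) = 1"
      using x y' by simp_all
    have "x' * y' * (y * w) = x' * (y' * y) * w" by (simp add: mult.assoc)
    then show ?thesis
      using spectral_ratioD(1)[OF f inv] spectral_ratioD(2)[OF f inv, of "y * w"] spectral_ratioD(1)[OF f y'] y' by simp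
  qed
  then show ?thesis
    using spectral_ratioD(1)[OF f y'] by (simp add: spectral_ratio_def)
qed

text \<open>The ratio lies in the spectrum of \<open>c\<close> times the unit, which contains only
  \<open>c\<close>.\<close>

lemma spectral_ratio_scale:
  fixes f :: "'a::cstar_algebra_1 \<Rightarrow> complex"
  assumes f: "spectral_ratio f" and x: "x \<in> invertibles"
  shows "f (c *\<^sub>C x) = c * f x"
proof -
  obtain x' where x': "x * x' = 1" "x' * x = 1" using x by (rule invertiblesE)
  have "f (c *\<^sub>C x) / f x \<in> spectrum (c *\<^sub>C (1::'a))"
    using spectral_ratioD(2)[OF f x', of "c *\<^sub>C x"] x' by (simp add: scaleC_simps)
  then have "f (c *\<^sub>C x) / f x = c" by (rule spectrum_scaleC_one)
  then show ?thesis using spectral_ratioD(1)[OF f x'] by (simp add: field_simps)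
qed

lemma spectral_ratio_of_real:
  "spectral_ratio f \<Longrightarrow> f (c *\<^sub>C 1) = c"
  using spectral_ratio_scale[of f 1 c] by (simp add: spectral_ratio_one)

lemma spectral_ratio_pos_cone_real:
  assumes "spectral_ratio f" "a \<in> pos_cone"
  shows "Im (f a) = 0"
  using assms spectrum_selfadjoint spectral_ratio_spectrum pos_cone_selfadjoint by blast

text \<open>For a in the cone and b self-adjoint, the spectrum of \<open>a\<inverse>b\<close> is real.\<close>

lemma spectral_ratio_Re:
  assumes f: "spectral_ratio f" and a: "a \<in> pos_cone" and b: "star b = b"
  shows "Re (f (a + \<i> *\<^sub>C b)) = Re (f a)"
proof -
  have "a \<in> invertibles" using pos_cone_plus_i_selfadjoint[OF a, of 0] by simp
  then obtain a' where a': "a * a' = 1" "a' * a = 1" by (rule invertiblesE)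
  define \<mu> where "\<mu> = f (a + \<i> *\<^sub>C b) / f a"
  define r \<tau> where "r = Re \<mu> - 1" and "\<tau> = Im \<mu>"
  have \<mu>: "\<mu> = 1 + (complex_of_real r + \<i> * complex_of_real \<tau>)"
    by (simp add: complex_eq_iff r_def \<tau>_def)
  \<comment> \<open>With \<mu> = 1 + r + \<i> \<tau>, the real part of \<open>z\<close> is r a. If r
    were nonzero, \<open>z\<close> or \<open>- z\<close> would be invertible, although \<mu> lies in
    the spectrum.\<close>
  define z where "z = complex_of_real r *\<^sub>C a + \<i> *\<^sub>C (complex_of_real \<tau> *\<^sub>C a - b)"
  have "\<mu> *\<^sub>C 1 - a' * (a + \<i> *\<^sub>C b) = a' * (\<mu> *\<^sub>C a - (a + \<i> *\<^sub>C b))"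
    using a' by (simp add: scaleC_simps distrib_left right_diff_distrib)
  also have "\<mu> *\<^sub>C a - (a + \<i> *\<^sub>C b) = z"
    by (simp add: \<mu> z_def scaleC_simps)
  finally have z: "\<mu> *\<^sub>C 1 - a' * (a + \<i> *\<^sub>C b) = a' * z" .
  have sa: "star (complex_of_real \<tau> *\<^sub>C a - b) = complex_of_real \<tau> *\<^sub>C a - b"
    using a b by (simp add: star_simps pos_cone_selfadjoint)
  have "z \<notin> invertibles"
  proof
    assume "z \<in> invertibles"
    then have "a' * z \<in> invertibles"
      using a' by (intro invertibles_mult) (auto intro: invertiblesI)
    then show False
      using spectral_ratioD(2)[OF f a', of "a + \<i> *\<^sub>C b"] z by (simp add: spectrum_def \<mu>_def)
  qed
  moreover have "z \<in> invertibles" if "r > 0"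
    unfolding z_def by (intro pos_cone_plus_i_selfadjoint pos_cone_scale a that sa)
  moreover have "z \<in> invertibles" if "r < 0"
  proof -
    have "(-1) *\<^sub>C (complex_of_real (- r) *\<^sub>C a + \<i> *\<^sub>C (- (complex_of_real \<tau> *\<^sub>C a - b))) \<in> invertibles"
      using that a sa
      by (intro invertibles_scaleC pos_cone_plus_i_selfadjoint pos_cone_scale) (simp_all only: star_minus, simp_all)
    then show ?thesis by (simp add: z_def scaleC_simps algebra_simps)
  qed
  ultimately have "Re \<mu> = 1" by (force simp: r_def)
  have "f (a + \<i> *\<^sub>C b) = \<mu> * f a"
    using spectral_ratioD(1)[OF f a'] by (simp add: \<mu>_def)
  then show ?thesis
    using \<open>Re \<mu> = 1\<close> spectral_ratio_pos_cone_real[OF f a] by simp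
qed

text \<open>Evaluate f at \<open>(1 + \<i>) (a + \<i> b) = \<i> ((a + b) - \<i> (a - b))\<close> in two ways.\<close>

lemma spectral_ratio_add_pos_cone:
  assumes f: "spectral_ratio f" and a: "a \<in> pos_cone" and b: "b \<in> pos_cone"
  shows "f (a + b) = f a + f b"
proof -
  have sa: "star a = a" "star b = b" using a b by (simp_all add: pos_cone_selfadjoint)
  define x where "x = a + \<i> *\<^sub>C b"
  define u where "u = b + \<i> *\<^sub>C (- a)"
  define v where "v = (a + b) + \<i> *\<^sub>C (b - a)"
  have inv: "x \<in> invertibles" "u \<in> invertibles" "v \<in> invertibles"
    unfolding x_def u_def v_def
    by (intro pos_cone_plus_i_selfadjoint pos_cone_add a b; simp add: star_simps sa)+
  have "x = \<i> *\<^sub>C u" by (simp add: x_def u_def scaleC_simps)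
  then have fu: "f x = \<i> * f u" using spectral_ratio_scale[OF f inv(2)] by simp
  have "(1 + \<i>) *\<^sub>C x = \<i> *\<^sub>C v" by (simp add: x_def v_def scaleC_simps algebra_simps)
  then have fv: "(1 + \<i>) * f x = \<i> * f v"
    using spectral_ratio_scale[OF f inv(1)] spectral_ratio_scale[OF f inv(3)] by metis
  have "Re (f x) = Re (f a)" unfolding x_def by (intro spectral_ratio_Re f a sa)
  moreover have "Re (f u) = Re (f b)"
    unfolding u_def by (intro spectral_ratio_Re f b) (simp add: star_simps sa)
  moreover have "Re (f v) = Re (f (a + b))"
    unfolding v_def by (intro spectral_ratio_Re f pos_cone_add a b) (simp add: star_simps sa)
  \<comment> \<open>The imaginary part of \<open>fv\<close> reads Re (f x) + Im (f x) = Re (f v),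
    and \<open>fu\<close> gives Im (f x) = Re (f u).\<close>
  ultimately have "Re (f (a + b)) = Re (f a) + Re (f b)"
    using fu fv by (simp add: complex_eq_iff)
  then show ?thesis
    using spectral_ratio_pos_cone_real[OF f] a b pos_cone_add[OF a b] by (simp add: complex_eq_iff)
qed

text \<open>Rotating \<open>a + \<i> b\<close> by the factor \<open>1 - \<i> \<tau>\<close> makes the imaginary part of f visible.\<close>

lemma spectral_ratio_Im:
  assumes f: "spectral_ratio f" and x: "x \<in> right_half"
    and \<tau>: "Re_part x + complex_of_real \<tau> *\<^sub>C Im_part x \<in> pos_cone"
  shows "Re (f x) + \<tau> * Im (f x) = Re (f (Re_part x + complex_of_real \<tau> *\<^sub>C Im_part x))"
proof -
  let ?a = "Re_part x" and ?b = "Im_part x"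
  have "(1 - \<i> * complex_of_real \<tau>) *\<^sub>C (?a + \<i> *\<^sub>C ?b)
      = (?a + complex_of_real \<tau> *\<^sub>C ?b) + \<i> *\<^sub>C (?b - complex_of_real \<tau> *\<^sub>C ?a)"
    by (simp add: scaleC_simps algebra_simps)
  then have "f ((1 - \<i> * complex_of_real \<tau>) *\<^sub>C x)
      = f ((?a + complex_of_real \<tau> *\<^sub>C ?b) + \<i> *\<^sub>C (?b - complex_of_real \<tau> *\<^sub>C ?a))"
    using Re_Im_part[of x] by simp
  moreover have "Re (f ((?a + complex_of_real \<tau> *\<^sub>C ?b) + \<i> *\<^sub>C (?b - complex_of_real \<tau> *\<^sub>C ?a)))
      = Re (f (?a + complex_of_real \<tau> *\<^sub>C ?b))"
    by (intro spectral_ratio_Re f \<tau>) (simp add: star_simps)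
  ultimately have "Re ((1 - \<i> * complex_of_real \<tau>) * f x) = Re (f (?a + complex_of_real \<tau> *\<^sub>C ?b))"
    unfolding spectral_ratio_scale[OF f right_half_invertible[OF x]] by simp
  then show ?thesis by simp
qed

text \<open>Real parts reduce to additivity on the cone. So do the values Re (f z) + \<tau> Im (f
  z), for one small \<tau> > 0 that serves \<open>x\<close>, \<open>y\<close> and
  \<open>x + y\<close>; dividing by \<tau> gives the imaginary parts.\<close>

lemma spectral_ratio_add:
  assumes f: "spectral_ratio f" and x: "x \<in> right_half" and y: "y \<in> right_half"
  shows "f (x + y) = f x + f y"
proof -
  note xy = right_half_add[OF x y]
  define g where "g \<tau> z = Re_part z + complex_of_real \<tau> *\<^sub>C Im_part z" for \<tau> and z :: 'a
  have g_add: "g \<tau> (x + y) = g \<tau> x + g \<tau> y" for \<tau>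
    by (simp add: g_def Re_part_add Im_part_add scaleC_simps)
  have Re_f: "Re (f z) = Re (f (Re_part z))" if "z \<in> right_half" for z
    using spectral_ratio_Re[OF f, of "Re_part z" "Im_part z"] Re_Im_part[of z] that
    by (simp add: right_half_def)
  have "\<forall>\<^sub>F \<tau> in at_right 0. g \<tau> z \<in> pos_cone" if "z \<in> right_half" for z
    unfolding g_def using that by (intro pos_cone_eventually) (simp_all add: right_half_def)
  then have "\<forall>\<^sub>F \<tau> in at_right 0. g \<tau> x \<in> pos_cone \<and> g \<tau> y \<in> pos_cone \<and> (0::real) < \<tau>"
    using x y by (intro eventually_conj eventually_at_right_less) auto
  then obtain \<tau> where \<tau>: "g \<tau> x \<in> pos_cone" "g \<tau> y \<in> pos_cone" "0 < \<tau>"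
    using eventually_happens'[OF trivial_limit_at_right_real] by blast
  have \<tau>xy: "g \<tau> (x + y) \<in> pos_cone" using \<tau> by (simp add: g_add pos_cone_add)
  have *: "Re (f z) + \<tau> * Im (f z) = Re (f (g \<tau> z))"
    if "z \<in> right_half" "g \<tau> z \<in> pos_cone" for z
    using spectral_ratio_Im[OF f that(1)] that(2) by (simp add: g_def)
  have "Re (f (x + y)) = Re (f x) + Re (f y)"
    using Re_f[OF x] Re_f[OF y] Re_f[OF xy] spectral_ratio_add_pos_cone[OF f] x y
    by (simp add: right_half_def Re_part_add)
  moreover have "Re (f (g \<tau> (x + y))) = Re (f (g \<tau> x)) + Re (f (g \<tau> y))"
    using spectral_ratio_add_pos_cone[OF f \<tau>(1,2)] by (simp add: g_add)
  ultimately have "\<tau> * Im (f (x + y)) = \<tau> * (Im (f x) + Im (f y))"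
    using *[OF x \<tau>(1)] *[OF y \<tau>(2)] *[OF xy \<tau>xy] by (simp add: distrib_left)
  then show ?thesis
    using \<open>Re (f (x + y)) = _\<close> \<tau>(3) by (simp add: complex_eq_iff)
qed

section \<open>Characters\<close>

text \<open>Multiplicativity is derived later from the spectral values, in the manner of the
  Gleason-Kahane-Zelazko theorem.\<close>

definition spectral_functional :: "('a::cstar_algebra_1 \<Rightarrow> complex) \<Rightarrow> bool"
  where "spectral_functional \<eta> \<longleftrightarrow> (\<forall>x y. \<eta> (x + y) = \<eta> x + \<eta> y) \<and>
    (\<forall>c x. \<eta> (c *\<^sub>C x) = c * \<eta> x) \<and> (\<forall>x. \<eta> x \<in> spectrum x)"

text \<open>Adding a large multiple of 1 moves any element into \<open>right_half\<close>, where
  \<open>f\<close> is additive. The value extended from there does not depend on the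
  multiple.\<close>

lemma spectral_ratio_functional:
  fixes f :: "'a::cstar_algebra_1 \<Rightarrow> complex"
  assumes f: "spectral_ratio f"
  obtains \<eta> where "spectral_functional \<eta>" "\<And>x. x \<in> right_half \<Longrightarrow> f x = \<eta> x"
proof -
  define e where "e t = complex_of_real t *\<^sub>C (1::'a)" for t
  have e_add: "e (s + t) = e s + e t" for s t by (simp add: e_def scaleC_simps)
  have fe: "f (e t) = complex_of_real t" for t
    by (simp add: e_def spectral_ratio_of_real f)
  have e_right: "e t \<in> right_half" if "t > 0" for t
    unfolding e_def by (rule right_half_of_real[OF that])
  define \<eta> where "\<eta> x = f (x + e (norm x + 1)) - complex_of_real (norm x + 1)" for x
  have \<eta>: "\<eta> x = f (x + e t) - complex_of_real t" if "x + e t \<in> right_half" "t \<ge> 0" for x t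
  proof -
    let ?s = "norm x + 1"
    have s: "?s > 0" by (simp add: add_nonneg_pos)
    have xs: "x + e ?s \<in> right_half"
      unfolding e_def by (rule right_half_shift) simp
    have "f (x + e t + e ?s) = f (x + e t) + complex_of_real ?s"
      using spectral_ratio_add[OF f that(1) e_right[OF s]] by (simp only: fe)
    moreover have "f (x + e ?s + e t) = f (x + e ?s) + complex_of_real t"
    \<comment> \<open>Additivity needs \<open>e t\<close> in \<open>right_half\<close>, so t = 0 is
      separate. That case later identifies \<open>f\<close> with \<eta> on
      \<open>right_half\<close>.\<close>
    proof (cases "t = 0")
      case False
      then show ?thesis
        using spectral_ratio_add[OF f xs e_right[of t]] that(2) by (simp only: fe)
    qed (simp add: e_def)
    moreover have "x + e t + e ?s = x + e ?s + e t" by (simp add: ac_simps)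
    ultimately show ?thesis by (simp add: \<eta>_def algebra_simps)
  qed
  have \<eta>_big: "\<eta> x = f (x + e t) - complex_of_real t" if "norm x < t" for x t
    using that norm_ge_zero[of x] unfolding e_def[symmetric]
    by (intro \<eta>) (simp_all add: e_def right_half_shift del: norm_ge_zero)
  have f_eq: "f x = \<eta> x" if "x \<in> right_half" for x
    using \<eta>[of x 0] that by (simp add: e_def)
  have add: "\<eta> (x + y) = \<eta> x + \<eta> y" for x y
  proof -
    let ?s = "norm x + 1" and ?t = "norm y + 1"
    have "f ((x + e ?s) + (y + e ?t)) = f (x + e ?s) + f (y + e ?t)"
      unfolding e_def by (intro spectral_ratio_add f right_half_shift) simp_all
    moreover have "(x + e ?s) + (y + e ?t) = x + y + e (?s + ?t)"
      unfolding e_add by (simp only: ac_simps)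
    moreover have "\<eta> (x + y) = f (x + y + e (?s + ?t)) - complex_of_real (?s + ?t)"
      using norm_triangle_ineq[of x y] by (intro \<eta>_big) simp
    ultimately show ?thesis by (simp add: \<eta>_def algebra_simps)
  qed
  have zero: "\<eta> 0 = 0" using add[of 0 0] by simp
  have minus: "\<eta> (- x) = - \<eta> x" for x using add[of x "- x"] zero by (simp add: add_eq_0_iff)
  have pos: "\<eta> (complex_of_real r *\<^sub>C x) = complex_of_real r * \<eta> x" if "r > 0" for r x
  proof -
    let ?s = "norm x + 1"
    have "f (complex_of_real r *\<^sub>C (x + e ?s)) = complex_of_real r * f (x + e ?s)"
      unfolding e_def by (intro spectral_ratio_scale f right_half_invertible right_half_shift) simp
    moreover have "complex_of_real r *\<^sub>C (x + e ?s) = complex_of_real r *\<^sub>C x + e (r * ?s)"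
      by (simp add: e_def scaleC.scale_right_distrib del: of_real_add)
    moreover have "\<eta> (complex_of_real r *\<^sub>C x)
        = f (complex_of_real r *\<^sub>C x + e (r * ?s)) - complex_of_real (r * ?s)"
      using that by (intro \<eta>_big) (simp add: norm_scaleC)
    ultimately show ?thesis by (simp add: \<eta>_def algebra_simps)
  qed
  have real: "\<eta> (complex_of_real r *\<^sub>C x) = complex_of_real r * \<eta> x" for r x
    using pos[of r x] pos[of "- r" x] minus[of "complex_of_real r *\<^sub>C x"] zero
    by (cases r "0::real" rule: linorder_cases) simp_all
  text \<open>Near a large multiple of the unit, multiplication by \<open>1 + \<i>\<close> does not leave the half plane.\<close>
  have near: "\<eta> (\<i> *\<^sub>C (y + e t)) = \<i> * \<eta> (y + e t)" if t: "2 * norm y < t" for y t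
  proof -
    let ?x = "y + e t"
    have x: "?x \<in> right_half"
      using t norm_ge_zero[of y] unfolding e_def by (intro right_half_shift) linarith
    \<comment> \<open>The real part of \<i> t 1 vanishes, so only y + \<i> y, of norm at most 2
      norm(y), has to be compensated by t.\<close>
    have "Re_part (?x + \<i> *\<^sub>C ?x) = Re_part (y + \<i> *\<^sub>C y + e t)"
      by (simp add: Re_part_add scaleC_simps)
        (simp add: e_def Re_part_def star_simps)
    moreover have "y + \<i> *\<^sub>C y + e t \<in> right_half"
      unfolding e_def using norm_triangle_ineq[of y "\<i> *\<^sub>C y"] t
      by (intro right_half_shift) (simp add: norm_scaleC)
    ultimately have x': "?x + \<i> *\<^sub>C ?x \<in> right_half" by (simp add: right_half_def)
    have "f ((1 + \<i>) *\<^sub>C ?x) = (1 + \<i>) * f ?x"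
      by (intro spectral_ratio_scale f right_half_invertible x)
    moreover have "(1 + \<i>) *\<^sub>C ?x = ?x + \<i> *\<^sub>C ?x"
      unfolding scaleC.scale_left_distrib by simp
    ultimately have "\<eta> (?x + \<i> *\<^sub>C ?x) = (1 + \<i>) * \<eta> ?x"
      using f_eq[OF x] f_eq[OF x'] by simp
    then show ?thesis unfolding add[of ?x "\<i> *\<^sub>C ?x"] by (simp add: algebra_simps)
  qed
  have i: "\<eta> (\<i> *\<^sub>C y) = \<i> * \<eta> y" for y
  proof -
    let ?t = "2 * norm y + 1"
    have "0 < ?t" by (simp add: add_nonneg_pos)
    then show ?thesis
      \<comment> \<open>Subtracting the instance at 0 removes the shift.\<close>
      using near[of y ?t] near[of 0 ?t]
      by (simp add: scaleC.scale_right_distrib add distrib_left)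
  qed
  have scale: "\<eta> (c *\<^sub>C x) = c * \<eta> x" for c x
  proof -
    have "c *\<^sub>C x = (complex_of_real (Re c) + \<i> * complex_of_real (Im c)) *\<^sub>C x"
      by (simp flip: complex_eq)
    also have "\<dots> = complex_of_real (Re c) *\<^sub>C x + \<i> *\<^sub>C complex_of_real (Im c) *\<^sub>C x"
      by (simp add: scaleC.scale_left_distrib)
    also have "\<eta> \<dots> = (complex_of_real (Re c) + \<i> * complex_of_real (Im c)) * \<eta> x"
      unfolding add i real by (simp add: algebra_simps)
    finally show ?thesis by (simp flip: complex_eq)
  qed
  have "\<eta> x \<in> spectrum x" for x
  proof -
    have "f (x + e (norm x + 1)) \<in> spectrum (x + e (norm x + 1))"
      by (rule spectral_ratio_spectrum[OF f])
    then show ?thesis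
      using spectrum_shift[of "\<eta> x" "complex_of_real (norm x + 1)" x]
      by (simp add: \<eta>_def e_def)
  qed
  then have "spectral_functional \<eta>" by (simp add: spectral_functional_def add scale)
  then show ?thesis using f_eq that by blast
qed

section \<open>Multiplicativity of linear functionals with spectral values\<close>

context
  fixes \<eta> :: "'a::cstar_algebra_1 \<Rightarrow> complex"
  assumes \<eta>: "spectral_functional \<eta>"
begin

lemma spectral_functional_add: "\<eta> (x + y) = \<eta> x + \<eta> y"
  and spectral_functional_scaleC: "\<eta> (c *\<^sub>C x) = c * \<eta> x"
  and spectral_functional_spectrum: "\<eta> x \<in> spectrum x"
  using \<eta> by (auto simp: spectral_functional_def)

lemma spectral_functional_diff: "\<eta> (x - y) = \<eta> x - \<eta> y"
  using spectral_functional_add[of "x - y" y] by simp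

lemma spectral_functional_of_complex: "\<eta> (c *\<^sub>C 1) = c"
  using spectral_functional_spectrum spectrum_scaleC_one by blast

lemma spectral_functional_one: "\<eta> 1 = 1"
  using spectral_functional_of_complex[of 1] by simp

lemma spectral_functional_nonzero:
  assumes "x \<in> invertibles" shows "\<eta> x \<noteq> 0"
proof
  assume "\<eta> x = 0"
  then have "- x \<notin> invertibles"
    using spectral_functional_spectrum[of x] by (simp add: spectrum_def)
  then show False using invertibles_scaleC[OF assms, of "-1"] by simp
qed

text \<open>The value at \<open>h + \<i> h\<^sup>2\<close> is \<open>s + \<i> s\<^sup>2\<close> for some real s in the spectrum of h.\<close>

lemma spectral_functional_square_selfadjoint:
  assumes h: "star h = h"
  shows "\<eta> (h * h) = (\<eta> h)\<^sup>2"
proof -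
  define \<mu> where "\<mu> = \<eta> (h + \<i> *\<^sub>C (h * h))"
  \<comment> \<open>\<alpha> and \<beta> are the roots of X^2 - \<i> X + \<i> \<mu>, which is \<i>
    times \<mu> - (X + \<i> X^2). The discriminant is (\<i> d)^2.\<close>
  define d where "d = csqrt (1 + 4 * \<i> * \<mu>)"
  define \<alpha> \<beta> where "\<alpha> = (\<i> - \<i> * d) / 2" and "\<beta> = (\<i> + \<i> * d) / 2"
  have sum: "\<alpha> + \<beta> = \<i>" by (simp add: \<alpha>_def \<beta>_def field_simps)
  have prod: "\<alpha> * \<beta> = \<i> * \<mu>"
  proof -
    have "4 * (\<alpha> * \<beta>) = d\<^sup>2 - 1"
      by (simp add: \<alpha>_def \<beta>_def power2_eq_square field_simps)
    also have "\<dots> = 4 * (\<i> * \<mu>)" by (simp add: d_def)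
    finally show ?thesis by simp
  qed
  have fact: "\<mu> *\<^sub>C 1 - (h + \<i> *\<^sub>C (h * h)) = (- \<i>) *\<^sub>C ((\<alpha> *\<^sub>C 1 - h) * (\<beta> *\<^sub>C 1 - h))"
  proof -
    have "(\<alpha> *\<^sub>C 1 - h) * (\<beta> *\<^sub>C 1 - h) = (\<alpha> * \<beta>) *\<^sub>C 1 - (\<alpha> + \<beta>) *\<^sub>C h + h * h"
      by (simp add: scaleC_simps algebra_simps)
    then show ?thesis by (simp add: sum prod scaleC_simps)
  qed
  have "\<mu> *\<^sub>C 1 - (h + \<i> *\<^sub>C (h * h)) \<notin> invertibles"
    using spectral_functional_spectrum[of "h + \<i> *\<^sub>C (h * h)"] by (simp add: \<mu>_def spectrum_def)
  then have "\<not> (\<alpha> *\<^sub>C 1 - h \<in> invertibles \<and> \<beta> *\<^sub>C 1 - h \<in> invertibles)"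
    unfolding fact using invertibles_scaleC[OF invertibles_mult, of _ _ "- \<i>"] by auto
  then have "\<alpha> \<in> spectrum h \<or> \<beta> \<in> spectrum h" by (simp add: spectrum_def)
  then obtain s where s: "s \<in> spectrum h" "s = \<alpha> \<or> s = \<beta>" by blast
  have "s * (\<i> - s) = \<i> * \<mu>"
    using s(2) sum prod by (metis add_diff_cancel_left' add_diff_cancel_right' mult.commute)
  then have "\<mu> = s + \<i> * s\<^sup>2"
    by (simp add: complex_eq_iff power2_eq_square algebra_simps)
  moreover have "Im s = 0" using spectrum_selfadjoint[OF h s(1)] .
  moreover have "Im (\<eta> h) = 0" "Im (\<eta> (h * h)) = 0"
    using spectrum_selfadjoint spectral_functional_spectrum h by (blast, metis star_mult)
  moreover have "\<mu> = \<eta> h + \<i> * \<eta> (h * h)"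
    by (simp add: \<mu>_def spectral_functional_add spectral_functional_scaleC)
  \<comment> \<open>As s, \<eta> h and \<eta> (h h) are real, comparing real and imaginary parts
    gives \<eta> h = s and \<eta> (h h) = s^2.\<close>
  ultimately show ?thesis by (simp add: complex_eq_iff power2_eq_square)
qed

text \<open>Polarising with the self-adjoint a + b gives the value at a b + b a, the cross term of
  (a + \<i> b)^2.\<close>

lemma spectral_functional_square: "\<eta> (x * x) = (\<eta> x)\<^sup>2"
proof -
  define a b where "a = Re_part x" and "b = Im_part x"
  have sa: "star a = a" "star b = b" by (simp_all add: a_def b_def)
  have x: "x = a + \<i> *\<^sub>C b" unfolding a_def b_def by (rule Re_Im_part)
  have "(a + b) * (a + b) = a * a + (a * b + b * a) + b * b" by (simp add: algebra_simps)
  then have "\<eta> (a * b + b * a) = \<eta> ((a + b) * (a + b)) - \<eta> (a * a) - \<eta> (b * b)"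
    by (simp add: spectral_functional_add)
  also have "\<eta> ((a + b) * (a + b)) = (\<eta> a + \<eta> b)\<^sup>2"
    using spectral_functional_square_selfadjoint[of "a + b"] sa
    by (simp only: star_add spectral_functional_add)
  also have "\<dots> - \<eta> (a * a) - \<eta> (b * b) = 2 * \<eta> a * \<eta> b"
    using sa by (simp add: spectral_functional_square_selfadjoint power2_eq_square algebra_simps)
  finally have ab: "\<eta> (a * b + b * a) = 2 * \<eta> a * \<eta> b" .
  have "x * x = a * a - b * b + \<i> *\<^sub>C (a * b + b * a)"
    by (simp add: x scaleC_simps algebra_simps)
  then show ?thesis
    using ab sa by (simp only: spectral_functional_add spectral_functional_diff spectral_functional_scaleC
      spectral_functional_square_selfadjoint x) (simp add: power2_eq_square algebra_simps)
qed

lemma spectral_functional_jordan: "\<eta> (x * y + y * x) = 2 * \<eta> x * \<eta> y"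
proof -
  have "(x + y) * (x + y) = x * x + (x * y + y * x) + y * y" by (simp add: algebra_simps)
  then have "\<eta> (x * y + y * x) = \<eta> ((x + y) * (x + y)) - \<eta> (x * x) - \<eta> (y * y)"
    by (simp add: spectral_functional_add)
  also have "\<dots> = (\<eta> x + \<eta> y)\<^sup>2 - (\<eta> x)\<^sup>2 - (\<eta> y)\<^sup>2"
    by (simp only: spectral_functional_square spectral_functional_add)
  finally show ?thesis by (simp add: power2_eq_square algebra_simps)
qed

text \<open>If \<open>\<eta> x = 0\<close>, then \<open>(x y - y x)\<^sup>2 = 2 (x (y x y) + (y x y) x) - (x y + y x)\<^sup>2\<close> has value 0.\<close>

lemma spectral_functional_mult: "\<eta> (x * y) = \<eta> x * \<eta> y"
proof -
  have kernel: "\<eta> (z * y) = 0" if z: "\<eta> z = 0" for z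
  proof -
    define p where "p = z * (y * z * y) + (y * z * y) * z"
    have "(z * y - y * z) * (z * y - y * z) = p + p - (z * y + y * z) * (z * y + y * z)"
      by (simp add: p_def algebra_simps)
    \<comment> \<open>Both are symmetrised products with the factor \<open>z\<close>, on which
      \<eta> vanishes.\<close>
    moreover have "\<eta> p = 0" "\<eta> (z * y + y * z) = 0"
      unfolding p_def by (simp_all add: spectral_functional_jordan z)
    ultimately have "(\<eta> (z * y - y * z))\<^sup>2 = 0"
      by (metis spectral_functional_square spectral_functional_add spectral_functional_diff
          add_0 diff_self power_zero_numeral)
    then have "\<eta> (z * y) = \<eta> (y * z)" by (simp add: spectral_functional_diff)
    then show ?thesis
      using \<open>\<eta> (z * y + y * z) = 0\<close> by (simp add: spectral_functional_add)
  qed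
  have "\<eta> ((x - \<eta> x *\<^sub>C 1) * y) = 0"
    by (intro kernel) (simp add: spectral_functional_diff spectral_functional_of_complex)
  then show ?thesis
    by (simp add: left_diff_distrib mult_scaleC_left spectral_functional_diff spectral_functional_scaleC)
qed

end

text \<open>A small multiple of \<open>z\<close> added to 1 lies in the ball; linearity and the
  common value at 1 recover the value at \<open>z\<close>.\<close>

lemma spectral_functional_eqI:
  assumes \<eta>: "spectral_functional \<eta>" and \<eta>': "spectral_functional \<eta>'"
    and "e > 0" and eq: "\<And>x. norm (x - 1) < e \<Longrightarrow> \<eta> x = \<eta>' x"
  shows "\<eta> z = \<eta>' z"
proof -
  define r where "r = e / (norm z + 1)"
  have "norm z + 1 > 0" by (simp add: add_nonneg_pos)
  then have r: "r > 0" "r * norm z < e" using \<open>e > 0\<close> by (simp_all add: r_def field_simps)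
  have "\<eta> (1 + complex_of_real r *\<^sub>C z) = \<eta>' (1 + complex_of_real r *\<^sub>C z)"
    using r by (intro eq) (simp add: norm_scaleC)
  then show ?thesis
    using r by (simp add: spectral_functional_add[OF \<eta>] spectral_functional_add[OF \<eta>']
        spectral_functional_scaleC[OF \<eta>] spectral_functional_scaleC[OF \<eta>']
        spectral_functional_one[OF \<eta>] spectral_functional_one[OF \<eta>'])
qed

section \<open>Propagation along the principal component\<close>

lemma right_half_near_one: "norm (x - 1) < 1 \<Longrightarrow> (x::'a::cstar_algebra_1) \<in> right_half"
  by (rule right_half_near[of _ 1]) simp

text \<open>The translate by \<open>y * u\<close> has its own character \<eta>'. For z close to 1
  the product u z stays in the unit ball about 1, so the hypothesis at \<open>y\<close> forces
  \<eta>' = \<eta> near 1 and hence everywhere.\<close>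

lemma character_step:
  fixes f :: "'a::cstar_algebra_1 \<Rightarrow> complex"
  assumes f: "spectral_ratio f" and \<eta>: "spectral_functional \<eta>"
    and y: "y \<in> invertibles" and u: "norm (u - 1) < 1"
    and eq: "\<And>x. norm (x - 1) < 1 \<Longrightarrow> f (y * x) = \<eta> y * \<eta> x"
    and x: "norm (x - 1) < 1"
  shows "f (y * u * x) = \<eta> (y * u) * \<eta> x"
proof -
  have u_inv: "u \<in> invertibles" by (rule invertibles_near_one[OF u])
  have yu: "y * u \<in> invertibles" by (rule invertibles_mult[OF y u_inv])
  have nz: "\<eta> y \<noteq> 0" "\<eta> u \<noteq> 0"
    using spectral_functional_nonzero[OF \<eta>] y u_inv by auto
  have fyu: "f (y * u) = \<eta> y * \<eta> u" by (rule eq[OF u])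
  obtain \<eta>' where \<eta>': "spectral_functional \<eta>'"
    and f_eq: "\<And>x. x \<in> right_half \<Longrightarrow> f (y * u * x) / f (y * u) = \<eta>' x"
    using spectral_ratio_functional[OF spectral_ratio_translate[OF f yu]] by blast
  \<comment> \<open>This radius keeps norm(u - 1) + norm(u) norm(z - 1) below 1.\<close>
  define e where "e = (1 - norm (u - 1)) / (norm u + 1)"
  have pos: "norm u + 1 > 0" by (simp add: add_nonneg_pos)
  then have "e > 0" using u by (simp add: e_def)
  have "\<eta>' z = \<eta> z" if z: "norm (z - 1) < min e 1" for z
  proof -
    have "norm (u * (z - 1)) \<le> norm u * norm (z - 1)" by (rule norm_mult_ineq)
    also have "\<dots> \<le> (norm u + 1) * norm (z - 1)" by (simp add: mult_right_mono)
    also have "\<dots> < 1 - norm (u - 1)" using z pos by (simp add: e_def field_simps)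
    finally have "norm ((u - 1) + u * (z - 1)) < 1"
      using norm_triangle_ineq[of "u - 1" "u * (z - 1)"] by simp
    then have "norm (u * z - 1) < 1" by (simp add: algebra_simps)
    then have "f (y * u * z) = \<eta> y * (\<eta> u * \<eta> z)"
      using eq[of "u * z"] by (simp add: mult.assoc spectral_functional_mult[OF \<eta>])
    then show ?thesis
      using f_eq[OF right_half_near_one, of z] z nz by (simp add: fyu)
  qed
  then have "\<eta>' x = \<eta> x"
    using spectral_functional_eqI[OF \<eta>' \<eta>, of "min e 1" x] \<open>e > 0\<close> by simp
  then show ?thesis
    using f_eq[OF right_half_near_one[OF x]] nz
    by (simp add: fyu spectral_functional_mult[OF \<eta>] field_simps)
qed

text \<open>The estimates use the fixed inverse \<open>a'\<close> in place of the inverse of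
  \<open>x\<close>, so one radius works for all pairs.\<close>

lemma invertible_nhd_quotients:
  fixes a :: "'a::cstar_algebra_1"
  assumes a: "a \<in> invertibles"
  obtains d where "d > 0"
    "\<And>x y. \<lbrakk>dist a x < d; dist a y < d; x \<in> invertibles\<rbrakk> \<Longrightarrow> \<exists>u. y = x * u \<and> norm (u - 1) < 1"
proof -
  obtain a' where a': "a * a' = 1" "a' * a = 1" using a by (rule invertiblesE)
  define d where "d = 1 / (4 * (norm a' + 1))"
  have pos: "norm a' + 1 > 0" by (simp add: add_nonneg_pos)
  have close: "norm (a' * (z - w)) < 2 * (1/4)" if "dist a z < d" "dist a w < d" for z w
  proof -
    have "norm (z - w) < 2 * d" using that dist_triangle_less_add[of z a d w d]
      by (simp add: dist_commute flip: dist_norm)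
    then have "(norm a' + 1) * norm (z - w) < (norm a' + 1) * (2 * d)"
      using pos by (intro mult_strict_left_mono)
    moreover have "norm (a' * (z - w)) \<le> (norm a' + 1) * norm (z - w)"
      using norm_mult_ineq[of a' "z - w"] by (simp add: distrib_right) (smt (verit) norm_ge_zero)
    moreover have "(norm a' + 1) * (2 * d) = 1/2" using pos by (simp add: d_def field_simps)
    ultimately show ?thesis by simp
  qed
  have close1: "norm (a' * (x - a)) < 1/4" if "dist a x < d" for x
  proof -
    have "(norm a' + 1) * norm (x - a) < (norm a' + 1) * d"
      using pos that by (intro mult_strict_left_mono) (simp_all add: dist_norm norm_minus_commute)
    moreover have "norm (a' * (x - a)) \<le> (norm a' + 1) * norm (x - a)"
      using norm_mult_ineq[of a' "x - a"] by (simp add: distrib_right) (smt (verit) norm_ge_zero)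
    moreover have "(norm a' + 1) * d = 1/4" using pos by (simp add: d_def field_simps)
    ultimately show ?thesis by simp
  qed
  have "\<exists>u. y = x * u \<and> norm (u - 1) < 1"
    if xa: "dist a x < d" and ya: "dist a y < d" and x: "x \<in> invertibles" for x y
  proof -
    obtain x' where x': "x * x' = 1" "x' * x = 1" using x by (rule invertiblesE)
    define u where "u = x' * y"
    have "x * u = x * x' * y" by (simp add: u_def mult.assoc)
    then have y: "y = x * u" using x' by simp
    \<comment> \<open>Expand a' (y - x) = a' x (u - 1) with a' x = 1 + a' (x - a). The bounds 1/4
      and 1/2 then give (3/4) norm(u - 1) < 1/2.\<close>
    have eq: "u - 1 = a' * (y - x) - a' * (x - a) * (u - 1)"
      by (simp add: y algebra_simps a')
    have "norm (u - 1) \<le> norm (a' * (y - x)) + norm (a' * (x - a) * (u - 1))"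
      by (subst eq) (rule norm_triangle_ineq4)
    moreover have "norm (a' * (x - a) * (u - 1)) \<le> norm (a' * (x - a)) * norm (u - 1)"
      by (rule norm_mult_ineq)
    moreover have "\<dots> \<le> 1/4 * norm (u - 1)"
      using close1[OF xa] by (intro mult_right_mono) simp_all
    moreover have "norm (a' * (y - x)) < 1/2" using close[OF ya xa] by simp
    ultimately have "norm (u - 1) < 1" by linarith
    then show ?thesis using y by blast
  qed
  moreover have "d > 0" using pos by (simp add: d_def)
  ultimately show ?thesis using that by blast
qed

lemma spectral_ratio_principal_component:
  fixes f :: "'a::cstar_algebra_1 \<Rightarrow> complex"
  assumes f: "spectral_ratio f" and \<eta>: "spectral_functional \<eta>"
    and eq: "\<And>x. x \<in> right_half \<Longrightarrow> f x = \<eta> x"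
    and b: "b \<in> principal_component"
  shows "f b = \<eta> b"
proof -
  let ?S = "principal_component :: 'a set"
  \<comment> \<open>Agreement on a whole translated ball is carried along, since
    \<open>character_step\<close> needs more than equality at \<open>y\<close>.\<close>
  define P where "P y \<longleftrightarrow> (\<forall>x. norm (x - 1) < 1 \<longrightarrow> f (y * x) = \<eta> y * \<eta> x)" for y
  have S_inv: "?S \<subseteq> invertibles"
    unfolding principal_component_def by (rule connected_component_subset)
  have "connected ?S" by (simp add: principal_component_def)
  moreover have "1 \<in> ?S" by (simp add: principal_component_def connected_component_refl)
  moreover note b
  moreover have "P 1"
    by (simp add: P_def eq right_half_near_one spectral_functional_one[OF \<eta>])
  ultimately have "P b"
  proof (rule connected_induction_simple)
    fix a assume a: "a \<in> ?S"
    with S_inv obtain d where d: "d > 0"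
      "\<And>x y. \<lbrakk>dist a x < d; dist a y < d; x \<in> invertibles\<rbrakk> \<Longrightarrow> \<exists>u. y = x * u \<and> norm (u - 1) < 1"
      using invertible_nhd_quotients[of a] by (metis subsetD)
    \<comment> \<open>The radius is uniform near \<open>a\<close>, so \<open>P\<close> passes from
      any point of the ball in the component to any other, as connected induction requires.\<close>
    have "P y" if xy: "x \<in> ?S \<inter> ball a d" "y \<in> ?S \<inter> ball a d" and "P x" for x y
    proof -
      have x: "x \<in> invertibles" using xy S_inv by blast
      then obtain u where u: "y = x * u" "norm (u - 1) < 1" using d(2)[of x y] xy by auto
      show ?thesis
        using character_step[OF f \<eta> x u(2)] \<open>P x\<close> unfolding P_def u(1) by blast
    qed
    moreover have "openin (top_of_set ?S) (?S \<inter> ball a d)" by (simp add: openin_open_Int)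
    moreover have "a \<in> ?S \<inter> ball a d" using a d(1) by simp
    ultimately show "\<exists>T. openin (top_of_set ?S) T \<and> a \<in> T \<and> (\<forall>x\<in>T. \<forall>y\<in>T. P x \<longrightarrow> P y)"
      by blast
  qed
  then have "f (b * 1) = \<eta> b * \<eta> 1" unfolding P_def by (metis diff_self norm_zero zero_less_one)
  then show ?thesis by (simp add: spectral_functional_one[OF \<eta>])
qed

text \<open>For t > 0, a + \<i> t = \<i> (t - \<i> a) is a rotated element of
  \<open>right_half\<close>, so homogeneity gives its value before the limit is taken.\<close>

lemma spectral_ratio_selfadjoint:
  fixes f :: "'a::cstar_algebra_1 \<Rightarrow> complex"
  assumes f: "spectral_ratio f" and \<eta>: "spectral_functional \<eta>"
    and eq: "\<And>x. x \<in> right_half \<Longrightarrow> f x = \<eta> x"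
    and cont: "continuous_on UNIV f" and a: "star a = a"
  shows "f a = \<eta> a"
proof -
  have f_eq: "f (a + (\<i> * complex_of_real t) *\<^sub>C 1) = \<eta> a + \<i> * complex_of_real t" if "t > 0" for t
  proof -
    define x where "x = complex_of_real t *\<^sub>C 1 + \<i> *\<^sub>C (- a)"
    have "Re_part x = complex_of_real t *\<^sub>C 1"
      unfolding x_def by (rule Re_part_eq) (simp_all add: star_simps a)
    moreover have "complex_of_real t *\<^sub>C (1::'a) \<in> pos_cone"
      using that by (intro pos_coneI[of _ t]) (simp_all add: star_simps)
    ultimately have x: "x \<in> right_half" by (simp add: right_half_def)
    have ix: "a + (\<i> * complex_of_real t) *\<^sub>C 1 = \<i> *\<^sub>C x" by (simp add: x_def scaleC_simps)
    have "f (\<i> *\<^sub>C x) = \<i> * \<eta> x"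
      using spectral_ratio_scale[OF f right_half_invertible[OF x]] eq[OF x] by simp
    also have "\<dots> = \<eta> (a + (\<i> * complex_of_real t) *\<^sub>C 1)"
      unfolding ix spectral_functional_scaleC[OF \<eta>] ..
    finally show ?thesis
      unfolding ix[symmetric] spectral_functional_add[OF \<eta>] spectral_functional_of_complex[OF \<eta>] .
  qed
  have "((\<lambda>t. (\<i> * complex_of_real t) *\<^sub>C (1::'a)) \<longlongrightarrow> 0) (at_right 0)"
    by (rule tendsto_norm_zero_cancel) (auto simp: norm_mult intro!: tendsto_eq_intros)
  then have "((\<lambda>t. a + (\<i> * complex_of_real t) *\<^sub>C 1) \<longlongrightarrow> a) (at_right 0)"
    using tendsto_add[OF tendsto_const, of _ 0 _ a] by simp
  then have "((\<lambda>t. f (a + (\<i> * complex_of_real t) *\<^sub>C 1)) \<longlongrightarrow> f a) (at_right 0)"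
    by (rule continuous_on_tendsto_compose[OF cont]) auto
  moreover have "\<forall>\<^sub>F t in at_right 0. \<eta> a + \<i> * complex_of_real t = f (a + (\<i> * complex_of_real t) *\<^sub>C 1)"
    using eventually_at_right_less[of "0::real"] by eventually_elim (simp add: f_eq)
  moreover have "((\<lambda>t. \<eta> a + \<i> * complex_of_real t) \<longlongrightarrow> \<eta> a) (at_right 0)"
    by (auto intro!: tendsto_eq_intros)
  ultimately show ?thesis
    by (blast intro: tendsto_unique[OF trivial_limit_at_right_real] Lim_transform_eventually)
qed

theorem theorem3p9:
  fixes \<phi> :: "'a::cstar_algebra_1 \<Rightarrow> complex"
  assumes P1: "\<And>x y. \<phi> x * \<phi> y \<in> spectrum (x * y)"
    and P2: "\<phi> 1 = 1"
    and P3: "continuous_on UNIV \<phi>"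
  shows "\<forall>x \<in> principal_component. psi \<phi> x = \<phi> x"
proof
  fix x :: 'a assume x: "x \<in> principal_component"
  have "\<phi> x \<noteq> 0 \<and> \<phi> w / \<phi> x \<in> spectrum (x' * w)" if "x * x' = 1" "x' * x = 1" for x x' w
  proof -
    \<comment> \<open>The unit has spectrum {1}, so values at inverse elements are reciprocal and
      products become ratios.\<close>
    have "\<phi> x' * \<phi> x = 1"
      using P1[of x' x] spectrum_scaleC_one[of "\<phi> x' * \<phi> x" 1] that by simp
    moreover from this have "\<phi> x \<noteq> 0" by auto
    ultimately have "\<phi> x \<noteq> 0" "\<phi> x' = 1 / \<phi> x" by (auto simp: eq_divide_eq)
    then show ?thesis using P1[of x' w] by simp
  qed
  then have f: "spectral_ratio \<phi>" by (simp add: spectral_ratio_def P2)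
  obtain \<eta> where \<eta>: "spectral_functional \<eta>" and eq: "\<And>x. x \<in> right_half \<Longrightarrow> \<phi> x = \<eta> x"
    using spectral_ratio_functional[OF f] by blast
  have "psi \<phi> x = \<eta> (Re_part x) + \<i> * \<eta> (Im_part x)"
    \<comment> \<open>Both parts of \<open>x\<close> are self-adjoint; membership in the component
      enters only in the last equality.\<close>
    by (simp add: psi_def spectral_ratio_selfadjoint[OF f \<eta> eq P3])
  also have "\<dots> = \<eta> (Re_part x + \<i> *\<^sub>C Im_part x)"
    by (simp add: spectral_functional_add[OF \<eta>] spectral_functional_scaleC[OF \<eta>])
  also have "\<dots> = \<phi> x"
    using spectral_ratio_principal_component[OF f \<eta> eq x] Re_Im_part[of x] by simp
  finally show "psi \<phi> x = \<phi> x" .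
qed

end
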